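(* Let $L_B$ be a real random variable with density $f_{L_B}(u)=\frac{\pi}{2}\operatorname{sech}^2(\pi u)$, $u\in\mathbb{R}$. For every integer $k\ge1$ and every real $x\neq\frac12$, $$\mathfrak{B}^{-k}(x):=E\left(x-\tfrac12+\imath L_B\right)^{-k}=\begin{cases}\dfrac{(-1)^{k-1}}{(k-1)!}\,\psi^{(k)}(x), & x>\frac12,\\[2mm] -\dfrac{1}{(k-1)!}\,\psi^{(k)}(1-x), & x<\frac12.\end{cases}$$ In particular, for $x=1$, $$\mathfrak{B}^{-k}(1)=E\left(\tfrac12+\imath L_B\right)^{-k}=k\,\zeta(k+1).$$
   Context: $\imath$ is the imaginary unit, $\psi=\Gamma'/\Gamma$ is the digamma function, $\psi^{(k)}$ is its $k$-th derivative, and $\zeta$ is the Riemann zeta function. $E$ denotes expectation: $E\,g(L_B)=\int_{\mathbb{R}}g(u)\,\frac{\pi}{2}\operatorname{sech}^2(\pi u)\,du$. The function $h(\mathfrak{B}(x))$ of the Bernoulli umbra is understood as $E\,h(x-\frac12+\imath L_B)$, here with $h(u)=u^{-k}$. *)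

theory Defs
  imports "HOL-Probability.Probability"
begin

definition logistic_density :: "real \<Rightarrow> real" where
  "logistic_density u = pi / 2 * (1 / cosh (pi * u))\<^sup>2"

text \<open>
  Evaluation of \<open>h\<close> at the Bernoulli umbra: \<open>E h(x - 1/2 + \<i> L)\<close>, where the random variable \<open>L\<close>
  lives on the probability space \<open>M\<close>.
\<close>
definition bernoulli_umbra ::
  "'a measure \<Rightarrow> ('a \<Rightarrow> real) \<Rightarrow> (complex \<Rightarrow> complex) \<Rightarrow> real \<Rightarrow> complex" where
  "bernoulli_umbra M L h x =
     integral\<^sup>L M (\<lambda>\<omega>. h (complex_of_real (x - 1/2) + \<i> * complex_of_real (L \<omega>)))"

text \<open>
  The Riemann zeta function on its half-plane of convergence \<open>Re s > 1\<close>; the values of \<open>zeta s\<close>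
  for other \<open>s\<close> are not meaningful.
\<close>
definition zeta :: "complex \<Rightarrow> complex" where
  "zeta s = (\<Sum>n. 1 / of_nat (Suc n) powr s)"

text \<open>
  The library introduces \<^const>\<open>Digamma\<close> by a series; it is the logarithmic derivative of
  the Gamma function.
\<close>
lemma Digamma_eq_deriv_Gamma:
  fixes x :: real
  assumes "x > 0"
  shows "Digamma x = deriv Gamma x / Gamma x"
proof -
  have "x \<notin> \<int>\<^sub>\<le>\<^sub>0"
    using assms by (auto elim!: nonpos_Ints_cases)
  then have "deriv Gamma x = Gamma x * Digamma x"
    by (intro DERIV_imp_deriv has_field_derivative_Gamma)
  then show ?thesis
    using Gamma_real_pos[OF assms] by simp
qed

end

theory Submission
  imports Defs "HOL-Complex_Analysis.Complex_Analysis"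
begin

text \<open>
  Write \<open>G k a = E (a + \<i> L)\<^sup>-\<^sup>k\<close>, the constant \<open>inverse_moment k a\<close> below. The theorem rests on the
  difference equation \<open>G k a - G k (a + 1) = k / (a + 1/2)\<^sup>k\<^sup>+\<^sup>1\<close> for \<open>a > 0\<close>
  (\<open>inverse_moment_step\<close>).

  On the line \<open>z = a + \<i> u\<close> the logistic density is
  \<open>(\<pi>/2) / sin\<^sup>2 (\<pi> (z - c))\<close> with \<open>c = a + 1/2\<close>. This function has period 1, so it restricts to
  the same density on the line \<open>z = a + 1 + \<i> u\<close>. Hence \<open>\<i> (G k (a + 1) - G k a)\<close> is the limit, as the
  height grows, of the integrals of \<open>(\<pi>/2) z\<^sup>-\<^sup>k / sin\<^sup>2 (\<pi> (z - c))\<close> around rectangles between the two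
  lines: on the horizontal sides the integrand tends to 0 because \<open>\<bar>sin z\<bar> \<ge> \<bar>sinh (Im z)\<bar>\<close>. The
  only singularity inside is the double pole at \<open>c\<close>, and the residue theorem gives the difference
  equation (\<open>contour_integral_inverse_power_over_sin_squared\<close>).

  Since \<open>\<bar>G k a\<bar> \<le> a\<^sup>-\<^sup>k\<close> tends to 0 as \<open>a\<close> grows, the differences telescope to
  \<open>G k a = (\<Sum>n. k / (a + 1/2 + n)\<^sup>k\<^sup>+\<^sup>1)\<close> (\<open>inverse_moment_sums\<close>). Up to the factor
  \<open>(-1)\<^sup>k\<^sup>-\<^sup>1 / (k - 1)!\<close>, this is the series of the \<open>k\<close>-th derivative of the digamma function at
  \<open>x = a + 1/2\<close>, and for \<open>a = 1/2\<close> it is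
  \<open>k \<zeta>(k + 1)\<close>. The case \<open>x < 1/2\<close> follows from the symmetry of the density, which gives
  \<open>G k (- a) = (-1)\<^sup>k G k a\<close>.
\<close>

section \<open>The logistic density and its inverse moments\<close>

lemma logistic_density_nonneg: "logistic_density u \<ge> 0"
  by (simp add: logistic_density_def)

lemma continuous_on_logistic_density: "continuous_on A logistic_density"
  unfolding logistic_density_def by (intro continuous_intros) auto

lemma borel_measurable_logistic_density [measurable]: "logistic_density \<in> borel_measurable borel"
  by (intro borel_measurable_continuous_onI continuous_on_logistic_density)

lemma logistic_density_minus: "logistic_density (- u) = logistic_density u"
  by (simp add: logistic_density_def)

lemma
  shows integrable_logistic_density: "integrable lborel logistic_density"
    and integral_logistic_density: "integral\<^sup>L lborel logistic_density = 1"
proof -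
  define F where "F = (\<lambda>u::real. tanh (pi * u) / 2)"
  have deriv: "DERIV F u :> logistic_density u" for u
  proof -
    have "cosh (pi * u) \<noteq> 0"
      by simp
    then have "1 - (tanh (pi * u))\<^sup>2 = (1 / cosh (pi * u))\<^sup>2"
      by (simp add: tanh_def power_divide sinh_square_eq diff_divide_distrib)
    then show ?thesis
      unfolding F_def logistic_density_def by (auto intro!: derivative_eq_intros)
  qed
  have top: "((F \<circ> real_of_ereal) \<longlongrightarrow> 1 / 2) (at_left \<infinity>)"
    unfolding ereal_tendsto_simps F_def
    by (intro tendsto_divide filterlim_compose[OF tanh_real_at_top] tendsto_const
        filterlim_tendsto_pos_mult_at_top[OF tendsto_const] filterlim_ident) auto
  have bot: "((F \<circ> real_of_ereal) \<longlongrightarrow> - 1 / 2) (at_right (- \<infinity>))"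
    unfolding ereal_tendsto_simps F_def
    by (intro tendsto_divide filterlim_compose[OF tanh_real_at_bot] tendsto_const
        filterlim_tendsto_pos_mult_at_bot[OF tendsto_const] filterlim_ident) auto
  have cont: "isCont logistic_density u" for u
    using continuous_on_logistic_density[of UNIV] by (simp add: continuous_on_eq_continuous_at)
  note FTC = interval_integral_FTC_nonneg[of "- \<infinity>" "\<infinity>" F logistic_density, OF _ deriv cont _ bot top]
  show "integrable lborel logistic_density"
    using FTC(1) by (simp add: logistic_density_nonneg set_integrable_def)
  show "integral\<^sup>L lborel logistic_density = 1"
    using FTC(2) by (simp add: logistic_density_nonneg interval_integral_to_infinity_eq interval_lebesgue_integral_def
        set_lebesgue_integral_def)
qed

text \<open>
  The expectation of \<open>(a + \<i> L)\<^sup>-\<^sup>k\<close> for a random variable \<open>L\<close> with the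
  logistic density. For \<open>a = 0\<close> and \<open>k \<ge> 1\<close> the integrand is not integrable, and the value is the
  default 0.
\<close>
definition inverse_moment :: "nat \<Rightarrow> real \<Rightarrow> complex" where
  "inverse_moment k a =
     (LINT u|lborel. of_real (logistic_density u) / (of_real a + \<i> * of_real u) ^ k)"

lemma norm_inverse_power_le:
  assumes "a \<noteq> 0"
  shows "norm (1 / (complex_of_real a + \<i> * of_real u) ^ k) \<le> 1 / \<bar>a\<bar> ^ k"
proof -
  have "\<bar>a\<bar> \<le> norm (complex_of_real a + \<i> * of_real u)"
    using abs_Re_le_cmod[of "complex_of_real a + \<i> * of_real u"] by simp
  then show ?thesis
    using assms by (auto simp: norm_divide norm_power intro!: divide_left_mono power_mono mult_pos_pos
        zero_less_power)
qed

lemma integrable_inverse_moment: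
  assumes "a \<noteq> 0"
  shows "integrable lborel
    (\<lambda>u. of_real (logistic_density u) / (complex_of_real a + \<i> * of_real u) ^ k)"
proof (rule Bochner_Integration.integrable_bound)
  show "integrable lborel (\<lambda>u. logistic_density u * (1 / \<bar>a\<bar> ^ k))"
    using integrable_logistic_density by simp
  show "AE u in lborel. norm (of_real (logistic_density u) / (complex_of_real a + \<i> * of_real u) ^ k)
      \<le> norm (logistic_density u * (1 / \<bar>a\<bar> ^ k))"
  proof (rule AE_I2)
    fix u
    show "norm (of_real (logistic_density u) / (complex_of_real a + \<i> * of_real u) ^ k)
        \<le> norm (logistic_density u * (1 / \<bar>a\<bar> ^ k))"
      using mult_left_mono[OF norm_inverse_power_le[OF assms, of u k] logistic_density_nonneg[of u]]
      by (simp add: norm_divide norm_mult logistic_density_nonneg)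
  qed
qed measurable

lemma norm_inverse_moment_le:
  assumes "a \<noteq> 0"
  shows "norm (inverse_moment k a) \<le> 1 / \<bar>a\<bar> ^ k"
proof -
  have "norm (inverse_moment k a) \<le> (LINT u|lborel. logistic_density u * (1 / \<bar>a\<bar> ^ k))"
    unfolding inverse_moment_def
  proof (rule Bochner_Integration.integral_norm_bound_integral[OF integrable_inverse_moment[OF assms]])
    show "integrable lborel (\<lambda>u. logistic_density u * (1 / \<bar>a\<bar> ^ k))"
      using integrable_logistic_density by simp
    show "norm (of_real (logistic_density u) / (complex_of_real a + \<i> * of_real u) ^ k)
        \<le> logistic_density u * (1 / \<bar>a\<bar> ^ k)" for u
      using mult_left_mono[OF norm_inverse_power_le[OF assms, of u k] logistic_density_nonneg[of u]]
      by (simp add: norm_divide norm_mult logistic_density_nonneg)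
  qed
  then show ?thesis
    by (simp add: integral_logistic_density)
qed

lemma inverse_moment_minus: "inverse_moment k (- a) = (- 1) ^ k * inverse_moment k a"
proof -
  have "inverse_moment k (- a) =
      (LINT u|lborel. of_real (logistic_density (- u)) / (of_real (- a) + \<i> * of_real (- u)) ^ k)"
    unfolding inverse_moment_def
    by (subst lborel_integral_real_affine[where c = "-1" and t = 0]) auto
  also have "\<dots> = (LINT u|lborel. (- 1) ^ k * (of_real (logistic_density u) / (of_real a + \<i> * of_real u) ^ k))"
  proof (rule Bochner_Integration.integral_cong[OF refl])
    fix u
    have "(of_real (- a) + \<i> * of_real (- u) :: complex) ^ k = (- 1) ^ k * (of_real a + \<i> * of_real u) ^ k"
      by (subst power_mult_distrib[symmetric]) (simp add: algebra_simps)
    then show "of_real (logistic_density (- u)) / (of_real (- a) + \<i> * of_real (- u)) ^ k =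
        (- 1) ^ k * (of_real (logistic_density u) / (complex_of_real a + \<i> * of_real u) ^ k)"
      by (cases "even k") (auto simp: logistic_density_minus)
  qed
  finally show ?thesis
    unfolding inverse_moment_def by (simp only: integral_mult_right_zero)
qed

section \<open>The difference equation of the inverse moments\<close>

lemma integral_interval_tendsto:
  fixes f :: "real \<Rightarrow> 'b :: euclidean_space"
  assumes "integrable lborel f"
  shows "(\<lambda>n. integral {- real n..real n} f) \<longlonglongrightarrow> integral\<^sup>L lborel f"
proof -
  have eq: "integral {- real n..real n} f = (LINT u|lborel. indicator {- real n..real n} u *\<^sub>R f u)" for n
    using set_borel_integral_eq_integral(2)[of "{- real n..real n}" f]
      integrable_mult_indicator[OF _ assms, of "{- real n..real n}"]
    by (simp add: set_integrable_def set_lebesgue_integral_def)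
  show ?thesis
    unfolding eq
  proof (rule integral_dominated_convergence[where w = "\<lambda>u. norm (f u)"])
    show "AE u in lborel. (\<lambda>n. indicator {- real n..real n} u *\<^sub>R f u) \<longlonglongrightarrow> f u"
    proof (rule AE_I2)
      fix u :: real
      obtain N where N: "\<bar>u\<bar> \<le> real N"
        using real_arch_simple by blast
      have "eventually (\<lambda>n. indicator {- real n..real n} u *\<^sub>R f u = f u) sequentially"
        using eventually_ge_at_top[of N] by eventually_elim (use N in \<open>auto simp: indicator_def\<close>)
      then show "(\<lambda>n. indicator {- real n..real n} u *\<^sub>R f u) \<longlonglongrightarrow> f u"
        by (rule tendsto_eventually)
    qed
  qed (use assms in \<open>auto simp: indicator_def\<close>)
qed

lemma norm_sin_ge_sinh: "norm (sin z) \<ge> \<bar>sinh (Im z)\<bar>"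
proof -
  define e where "e = exp (Im z)"
  have "e > 0"
    by (simp add: e_def)
  then have "(e\<^sup>2 + inverse (e\<^sup>2) - 2 * (1 - 2 * (sin (Re z))\<^sup>2)) / 4
      = (sin (Re z))\<^sup>2 + ((e - inverse e) / 2)\<^sup>2"
    by (simp add: field_simps power2_eq_square)
  then have "norm (sin z) ^ 2 = (sin (Re z))\<^sup>2 + (sinh (Im z))\<^sup>2"
    by (simp only: norm_sin_squared sinh_field_def cos_double_sin exp_double exp_minus e_def)
  then have "(\<bar>sinh (Im z)\<bar>)\<^sup>2 \<le> norm (sin z) ^ 2"
    by simp
  then show ?thesis
    by (rule power2_le_imp_le) simp
qed

lemma sin_pi_zero_in_strip:
  assumes "sin (of_real pi * z) = 0" "\<bar>Re z\<bar> < 1"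
  shows "z = 0"
proof -
  obtain n :: int where "of_real pi * z = of_real (of_int n * pi)"
    using assms(1) unfolding sin_eq_0 by blast
  then have z: "z = of_int n"
    by simp
  then have "n = 0"
    using assms(2) by simp
  with z show ?thesis
    by simp
qed

text \<open>
  The double pole at \<open>c\<close> is reduced to a simple one by integrating by parts along the closed path:
  \<open>\<pi> / sin\<^sup>2 (\<pi> (z - c))\<close> is the derivative of \<open>- cot (\<pi> (z - c))\<close>, so the integrand differs by a derivative
  from \<open>- (k/2) cot (\<pi> (z - c)) z\<^sup>-\<^sup>k\<^sup>-\<^sup>1\<close>.
\<close>
lemma contour_integral_inverse_power_over_sin_squared:
  assumes path: "valid_path g" "pathfinish g = pathstart g"
    and image: "path_image g \<subseteq> {z. Re z > 0 \<and> \<bar>Re z - c\<bar> < 1} - {of_real c}"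
    and winding: "winding_number g (of_real c) = 1"
    and "c > 0"
  shows "contour_integral g (\<lambda>z. (of_real pi / 2) * (1 / z ^ k) / (sin (of_real pi * (z - of_real c)))\<^sup>2) =
    - (\<i> * of_nat k / of_real c ^ Suc k)"
proof -
  define S where "S = {z. Re z > 0 \<and> \<bar>Re z - c\<bar> < 1}"
  define s where "s = (\<lambda>z::complex. sin (of_real pi * (z - of_real c)))"
  define t where "t = (\<lambda>z::complex. cos (of_real pi * (z - of_real c)))"
  have "S = {z. Re z > 0} \<inter> {z. Re z > c - 1} \<inter> {z. Re z < c + 1}"
    by (auto simp: S_def)
  then have S: "open S" "convex S"
    by (auto intro!: convex_Int open_halfspace_Re_gt open_halfspace_Re_lt
        convex_halfspace_Re_gt convex_halfspace_Re_lt)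
  have S_nz: "z \<noteq> 0" if "z \<in> S" for z
    using that by (auto simp: S_def)
  have s_nz: "s z \<noteq> 0" if "z \<in> S - {of_real c}" for z
    using that sin_pi_zero_in_strip[of "z - of_real c"] by (auto simp: s_def S_def)
  have c: "of_real c \<in> S"
    using \<open>c > 0\<close> by (simp add: S_def)
  have ds: "(s has_field_derivative of_real pi * t z) (at z within A)" for z A
    unfolding s_def t_def by (auto intro!: derivative_eq_intros)
  have dt: "(t has_field_derivative - of_real pi * s z) (at z within A)" for z A
    unfolding s_def t_def by (auto intro!: derivative_eq_intros)
  have hol: "s holomorphic_on A" "t holomorphic_on A" for A
    unfolding s_def t_def by (auto intro!: holomorphic_intros)
  define P where "P = (\<lambda>z. - (t z / s z * (1 / z ^ k)) / 2)"
  define Q where "Q = (\<lambda>z. - (of_nat k / 2) * (t z / z ^ Suc k) / s z)"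
  define \<Phi> where "\<Phi> = (\<lambda>z. (of_real pi / 2) * (1 / z ^ k) / (s z)\<^sup>2)"
  have dP: "(P has_field_derivative \<Phi> z - Q z) (at z within S - {of_real c})"
    if z: "z \<in> S - {of_real c}" for z
  proof -
    have nz: "z \<noteq> 0" "s z \<noteq> 0"
      using z S_nz s_nz by auto
    have pyth: "(s z)\<^sup>2 + (t z)\<^sup>2 = 1"
      by (simp add: s_def t_def)
    have "((\<lambda>z. t z / s z) has_field_derivative - of_real pi / (s z)\<^sup>2) (at z within S - {of_real c})"
    proof -
      have "(- of_real pi * s z) * s z - t z * (of_real pi * t z) = - of_real pi * ((s z)\<^sup>2 + (t z)\<^sup>2)"
        by (simp add: algebra_simps power2_eq_square)
      then show ?thesis
        using DERIV_divide[OF dt ds nz(2), of "S - {of_real c}"] pyth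
        by (simp add: power2_eq_square)
    qed
    moreover have "((\<lambda>z. 1 / z ^ k) has_field_derivative - of_nat k / z ^ Suc k) (at z within S - {of_real c})"
    proof -
      have "((\<lambda>z. inverse (z ^ k)) has_field_derivative
          - (inverse (z ^ k) * (of_nat k * z ^ (k - 1)) * inverse (z ^ k))) (at z within S - {of_real c})"
        using nz by (auto intro!: derivative_eq_intros)
      also have "- (inverse (z ^ k) * (of_nat k * z ^ (k - 1)) * inverse (z ^ k)) = - of_nat k / z ^ Suc k"
        using nz by (cases k) (auto simp: field_simps)
      finally show ?thesis
        by (simp add: inverse_eq_divide)
    qed
    ultimately have "(P has_field_derivative
        - (- of_real pi / (s z)\<^sup>2 * (1 / z ^ k) + - of_nat k / z ^ Suc k * (t z / s z)) / 2)
        (at z within S - {of_real c})"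
      unfolding P_def by (intro DERIV_cdivide DERIV_minus DERIV_mult)
    also have "- (- of_real pi / (s z)\<^sup>2 * (1 / z ^ k) + - of_nat k / z ^ Suc k * (t z / s z)) / 2 = \<Phi> z - Q z"
      by (simp add: \<Phi>_def Q_def field_simps nz)
    finally show ?thesis .
  qed
  have primitive: "((\<lambda>z. \<Phi> z - Q z) has_contour_integral 0) g"
    using contour_integral_primitive[OF dP path(1)] image path(2) by (simp add: S_def)
  have holQ: "Q holomorphic_on S - {of_real c}"
    unfolding Q_def using s_nz S_nz by (intro holomorphic_intros hol) auto
  have S': "open (S - {of_real c})"
    using S(1) by (intro open_delete)
  have intQ: "Q contour_integrable_on g"
    using contour_integrable_holomorphic_simple[OF holQ S' path(1)] image by (simp add: S_def)
  have "residue Q (of_real c) = - (of_nat k / 2) * (t (of_real c) / of_real c ^ Suc k) / of_real pi"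
    \<comment> \<open>The residue rule for simple poles needs a nonzero numerator, which excludes \<open>k = 0\<close>.\<close>
    unfolding Q_def
  proof (cases "k = 0")
    case True
    then show "residue (\<lambda>z. - (of_nat k / 2) * (t z / z ^ Suc k) / s z) (of_real c) =
        - (of_nat k / 2) * (t (of_real c) / of_real c ^ Suc k) / of_real pi"
      by (simp add: residue_const)
  next
    case False
    show "residue (\<lambda>z. - (of_nat k / 2) * (t z / z ^ Suc k) / s z) (of_real c) =
        - (of_nat k / 2) * (t (of_real c) / of_real c ^ Suc k) / of_real pi"
    proof (rule residue_simple_pole_deriv[OF _ hol(1) S(1) _ c])
      show "(\<lambda>z. - (of_nat k / 2) * (t z / z ^ Suc k)) holomorphic_on S"
        using S_nz by (intro holomorphic_intros hol) auto
      show "(s has_field_derivative of_real pi) (at (of_real c))"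
        using ds[of "of_real c"] by (simp add: t_def)
    qed (use False \<open>c > 0\<close> S(2) in \<open>auto simp: s_def t_def intro: convex_connected\<close>)
  qed
  then have residue: "residue Q (of_real c) = - (of_nat k / (2 * of_real pi * of_real c ^ Suc k))"
    by (simp add: t_def)
  have "contour_integral g Q = 2 * pi * \<i> * (\<Sum>p\<in>{of_real c}. winding_number g p * residue Q p)"
  proof (rule Residue_theorem[OF S(1) convex_connected[OF S(2)] _ holQ path])
    show "\<forall>z. z \<notin> S \<longrightarrow> winding_number g z = 0"
      using winding_number_zero_outside[OF valid_path_imp_path[OF path(1)] S(2) path(2)] image
      by (auto simp: S_def)
  qed (use image in \<open>auto simp: S_def\<close>)
  then have "(Q has_contour_integral - (\<i> * of_nat k / of_real c ^ Suc k)) g"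
    using has_contour_integral_integral[OF intQ] by (simp add: residue winding)
  from has_contour_integral_add[OF primitive this]
  show ?thesis
    by (auto simp: \<Phi>_def s_def intro: contour_integral_unique)
qed

lemma inverse_moment_step:
  assumes "a > 0"
  shows "inverse_moment k a - inverse_moment k (a + 1) = of_nat k / of_real (a + 1 / 2) ^ Suc k"
proof -
  define c where "c = a + 1 / 2"
  have cosh: "cosh (complex_of_real v) = of_real (cosh v)" for v
    by (simp add: cosh_field_def exp_of_real flip: of_real_minus)
  define f where "f = (\<lambda>b u. complex_of_real (logistic_density u) / (of_real b + \<i> * of_real u) ^ k)"
  define \<Phi> where
    "\<Phi> = (\<lambda>z::complex. (of_real pi / 2) * (1 / z ^ k) / (sin (of_real pi * (z - of_real c)))\<^sup>2)"
  define D where "D = {z. Re z > 0 \<and> \<bar>Re z - c\<bar> < 1} - {complex_of_real c}"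
  \<comment> \<open>Horizontal sides, and the integrals over the vertical sides with the factor \<open>\<i>\<close> removed.\<close>
  define lo hi where "lo = (\<lambda>n. contour_integral (linepath (Complex a (- real n)) (Complex (a + 1) (- real n))) \<Phi>)"
    and "hi = (\<lambda>n. contour_integral (linepath (Complex (a + 1) (real n)) (Complex a (real n))) \<Phi>)"
  define V where "V = (\<lambda>b n. integral {- real n..real n} (f b))"
  have \<Phi>_left: "\<Phi> (Complex a u) = f a u" for u
  proof -
    have "of_real pi * (Complex a u - of_real c) = \<i> * of_real (pi * u) - of_real pi / 2"
      by (simp add: complex_eq_iff c_def algebra_simps)
    then have "sin (of_real pi * (Complex a u - of_real c)) = - of_real (cosh (pi * u))"
      by (simp only: sin_diff cosh_conv_cos[symmetric] cosh sin_of_real_pi_half cos_of_real_pi_half) simp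
    then show ?thesis
      by (simp add: \<Phi>_def f_def logistic_density_def complex_eq_cancel_iff2 Complex_eq power_divide)
  qed
  have \<Phi>_right: "\<Phi> (Complex (a + 1) u) = f (a + 1) u" for u
  proof -
    have "of_real pi * (Complex (a + 1) u - of_real c) = \<i> * of_real (pi * u) + of_real pi / 2"
      by (simp add: complex_eq_iff c_def algebra_simps)
    then have "sin (of_real pi * (Complex (a + 1) u - of_real c)) = of_real (cosh (pi * u))"
      by (simp only: sin_add cosh_conv_cos[symmetric] cosh sin_of_real_pi_half cos_of_real_pi_half) simp
    then show ?thesis
      by (simp add: \<Phi>_def f_def logistic_density_def complex_eq_cancel_iff2 Complex_eq power_divide)
  qed
  have cont: "continuous_on D \<Phi>"
  proof -
    have "z \<noteq> 0" "sin (of_real pi * (z - of_real c)) \<noteq> 0" if "z \<in> D" for z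
      using that sin_pi_zero_in_strip[of "z - of_real c"] by (auto simp: D_def)
    then show ?thesis
      unfolding \<Phi>_def by (intro continuous_intros) auto
  qed
  have rectangle: "lo n + \<i> * V (a + 1) n + hi n - \<i> * V a n = - (\<i> * of_nat k / of_real c ^ Suc k)"
    if "n > 0" for n
  proof -
    define g where "g = rectpath (Complex a (- real n)) (Complex (a + 1) (real n))"
    have image: "path_image g \<subseteq> D"
      using that \<open>a > 0\<close> by (auto simp: g_def path_image_rectpath D_def c_def)
    have "contour_integral g \<Phi> = - (\<i> * of_nat k / of_real c ^ Suc k)"
      unfolding \<Phi>_def
    proof (rule contour_integral_inverse_power_over_sin_squared)
      show "winding_number g (of_real c) = 1"
        unfolding g_def using that by (intro winding_number_rectpath) (auto simp: in_box_complex_iff c_def)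
      show "path_image g \<subseteq> {z. Re z > 0 \<and> \<bar>Re z - c\<bar> < 1} - {of_real c}"
        using image by (simp add: D_def)
    qed (use \<open>a > 0\<close> in \<open>auto simp: g_def c_def\<close>)
    moreover have "contour_integral g \<Phi> = lo n + \<i> * V (a + 1) n + hi n - \<i> * V a n"
    proof -
      have segs: "closed_segment (Complex a (- real n)) (Complex (a + 1) (- real n)) \<subseteq> D"
        "closed_segment (Complex (a + 1) (- real n)) (Complex (a + 1) (real n)) \<subseteq> D"
        "closed_segment (Complex (a + 1) (real n)) (Complex a (real n)) \<subseteq> D"
        "closed_segment (Complex a (real n)) (Complex a (- real n)) \<subseteq> D"
        using image by (auto simp: g_def rectpath_def Let_def path_image_join)
      note conts = segs[THEN continuous_on_subset[OF cont]]
      note int = conts[THEN contour_integrable_continuous_linepath]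
      have "contour_integral g \<Phi> = lo n +
          contour_integral (linepath (Complex (a + 1) (- real n)) (Complex (a + 1) (real n))) \<Phi> + hi n +
          contour_integral (linepath (Complex a (real n)) (Complex a (- real n))) \<Phi>"
        unfolding g_def rectpath_def Let_def lo_def hi_def
        using int by simp
      also have "contour_integral (linepath (Complex a (real n)) (Complex a (- real n))) \<Phi> =
          - contour_integral (linepath (Complex a (- real n)) (Complex a (real n))) \<Phi>"
        by (rule contour_integral_reverse_linepath[OF conts(4)])
      also have "contour_integral (linepath (Complex a (- real n)) (Complex a (real n))) \<Phi> = \<i> * V a n"
        using that by (subst contour_integral_linepath_same_Re) (auto simp: V_def \<Phi>_left)
      also have "contour_integral (linepath (Complex (a + 1) (- real n)) (Complex (a + 1) (real n))) \<Phi> = \<i> * V (a + 1) n"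
        using that by (subst contour_integral_linepath_same_Re) (auto simp: V_def \<Phi>_right)
      finally show ?thesis
        by simp
    qed
    ultimately show ?thesis
      by simp
  qed
  define B where "B = (\<lambda>n. (pi / 2) * (1 / a ^ k) / (sinh (pi * real n))\<^sup>2)"
  have edge: "norm (contour_integral (linepath (Complex p y) (Complex q y)) \<Phi>) \<le> B n"
    if "n > 0" "\<bar>y\<bar> = real n" "{p, q} = {a, a + 1}" for p q y n
  proof -
    have seg: "Im z = y \<and> a \<le> Re z \<and> Re z \<le> a + 1" if "z \<in> closed_segment (Complex p y) (Complex q y)" for z
    proof -
      have "z \<in> {z. Im z = y \<and> Re z \<in> {a..a + 1}}"
        using that closed_segment_same_Im[of "Complex p y" "Complex q y"] \<open>{p, q} = {a, a + 1}\<close>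
        by (auto simp: closed_segment_eq_real_ivl doubleton_eq_iff split: if_splits)
      then show ?thesis
        by simp
    qed
    have "y \<noteq> 0"
      using that by auto
    then have "closed_segment (Complex p y) (Complex q y) \<subseteq> D"
      using seg \<open>a > 0\<close> by (fastforce simp: D_def c_def)
    then have "\<Phi> contour_integrable_on linepath (Complex p y) (Complex q y)"
      by (intro contour_integrable_continuous_linepath continuous_on_subset[OF cont])
    moreover have "norm (\<Phi> z) \<le> B n" if z: "z \<in> closed_segment (Complex p y) (Complex q y)" for z
    proof -
      have "a \<le> norm z"
        using seg[OF z] complex_Re_le_cmod[of z] by linarith
      then have 1: "1 / norm z ^ k \<le> 1 / a ^ k"
        using \<open>a > 0\<close> by (intro divide_left_mono power_mono mult_pos_pos zero_less_power) auto
      have "\<bar>sinh (Im (of_real pi * (z - of_real c)))\<bar> = \<bar>sinh (pi * y)\<bar>"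
        using seg[OF z] by simp
      also have "\<dots> = sinh (pi * real n)"
        using \<open>\<bar>y\<bar> = real n\<close> by (metis abs_mult abs_of_nonneg pi_ge_zero sinh_real_abs)
      finally have "sinh (pi * real n) \<le> norm (sin (of_real pi * (z - of_real c)))"
        using norm_sin_ge_sinh[of "of_real pi * (z - of_real c)"] by simp
      then have 2: "(sinh (pi * real n))\<^sup>2 \<le> (norm (sin (of_real pi * (z - of_real c))))\<^sup>2"
        "(sinh (pi * real n))\<^sup>2 > 0"
        using \<open>n > 0\<close> by (auto intro!: power_mono)
      have "norm (\<Phi> z) = (pi / 2) * (1 / norm z ^ k) / (norm (sin (of_real pi * (z - of_real c))))\<^sup>2"
        by (simp add: \<Phi>_def norm_divide norm_mult norm_power)
      also have "\<dots> \<le> B n"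
        unfolding B_def using \<open>a > 0\<close> by (intro frac_le[OF _ mult_left_mono[OF 1] 2(2,1)]) auto
      finally show ?thesis .
    qed
    ultimately have "norm (contour_integral (linepath (Complex p y) (Complex q y)) \<Phi>)
        \<le> B n * norm (Complex q y - Complex p y)"
      using \<open>a > 0\<close> by (intro contour_integral_bound_linepath) (auto simp: B_def)
    also have "norm (Complex q y - Complex p y) = 1"
      using \<open>{p, q} = {a, a + 1}\<close> by (auto simp: doubleton_eq_iff norm_complex_def complex_diff)
    finally show ?thesis
      by simp
  qed
  have B: "B \<longlonglongrightarrow> 0"
  proof -
    have "filterlim (\<lambda>n. pi * real n) at_top sequentially"
      by (intro filterlim_tendsto_pos_mult_at_top[OF tendsto_const] filterlim_real_sequentially) auto
    then have "filterlim (\<lambda>n. sinh (pi * real n)) at_top sequentially"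
      by (rule filterlim_compose[OF sinh_real_at_top])
    then have "filterlim (\<lambda>n. (sinh (pi * real n))\<^sup>2) at_top sequentially"
      by (intro filterlim_pow_at_top) auto
    then show ?thesis
      unfolding B_def by (intro real_tendsto_divide_at_top[OF tendsto_const])
  qed
  have lo: "lo \<longlonglongrightarrow> 0"
    by (rule Lim_null_comparison[OF _ B])
       (use eventually_gt_at_top[of 0] in eventually_elim, auto simp: lo_def intro!: edge)
  have hi: "hi \<longlonglongrightarrow> 0"
    by (rule Lim_null_comparison[OF _ B])
       (use eventually_gt_at_top[of 0] in eventually_elim, auto simp: hi_def intro!: edge)
  have V: "V b \<longlonglongrightarrow> inverse_moment k b" if "b > 0" for b
    unfolding V_def inverse_moment_def f_def
    by (rule integral_interval_tendsto) (use that integrable_inverse_moment[of b k] in simp)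
  have "(\<lambda>n. lo n + \<i> * V (a + 1) n + hi n - \<i> * V a n)
      \<longlonglongrightarrow> 0 + \<i> * inverse_moment k (a + 1) + 0 - \<i> * inverse_moment k a"
    using \<open>a > 0\<close> by (intro tendsto_intros lo hi V) auto
  moreover have "(\<lambda>n. lo n + \<i> * V (a + 1) n + hi n - \<i> * V a n)
      \<longlonglongrightarrow> - (\<i> * of_nat k / of_real c ^ Suc k)"
    by (rule tendsto_eventually)
       (use eventually_gt_at_top[of 0] in eventually_elim, auto simp: rectangle)
  ultimately have "0 + \<i> * inverse_moment k (a + 1) + 0 - \<i> * inverse_moment k a =
      - (\<i> * of_nat k / of_real c ^ Suc k)"
    by (rule LIMSEQ_unique)
  then have "\<i> * (inverse_moment k a - inverse_moment k (a + 1)) = \<i> * (of_nat k / of_real c ^ Suc k)"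
    by (simp add: algebra_simps)
  then show ?thesis
    by (simp only: mult_cancel_left c_def) simp
qed

section \<open>The series for the inverse moments\<close>

lemma inverse_moment_sums:
  assumes "a > 0" "k \<ge> 1"
  shows "(\<lambda>n. of_nat k / of_real (a + 1 / 2 + real n) ^ Suc k) sums inverse_moment k a"
proof -
  have "(\<lambda>n. 1 / \<bar>a + real n\<bar> ^ k) \<longlonglongrightarrow> 0"
  proof -
    have "filterlim (\<lambda>n. a + real n) at_top sequentially"
      by (intro filterlim_tendsto_add_at_top[OF tendsto_const] filterlim_real_sequentially)
    then have "filterlim (\<lambda>n. \<bar>a + real n\<bar> ^ k) at_top sequentially"
      using \<open>k \<ge> 1\<close> by (intro filterlim_pow_at_top filterlim_compose[OF filterlim_abs_real]) auto
    then show ?thesis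
      by (intro real_tendsto_divide_at_top[OF tendsto_const])
  qed
  then have "(\<lambda>n. inverse_moment k (a + real n)) \<longlonglongrightarrow> 0"
    by (rule Lim_null_comparison[rotated])
       (use \<open>a > 0\<close> in \<open>intro always_eventually allI norm_inverse_moment_le, auto\<close>)
  from telescope_sums'[OF this]
  have "(\<lambda>n. inverse_moment k (a + real n) - inverse_moment k (a + real (Suc n))) sums inverse_moment k a"
    by simp
  moreover have "inverse_moment k (a + real n) - inverse_moment k (a + real (Suc n)) =
      of_nat k / of_real (a + 1 / 2 + real n) ^ Suc k" for n
    using inverse_moment_step[of "a + real n" k] \<open>a > 0\<close> by (simp add: add_ac)
  ultimately show ?thesis
    by simp
qed

lemma inverse_moment_eq_Polygamma:
  assumes "a > 0" "k \<ge> 1"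
  shows "inverse_moment k a = of_real ((- 1) ^ (k - 1) / fact (k - 1) * Polygamma k (a + 1 / 2))"
proof -
  have "(\<lambda>n. inverse ((a + 1 / 2 + real n) ^ Suc k)) sums
      ((- 1) ^ Suc k * Polygamma k (a + 1 / 2) / fact k)"
    using assms by (intro Polygamma_LIMSEQ) auto
  from sums_of_real[OF sums_mult[OF this, of "real k"], where ?'a = complex]
  have "(\<lambda>n. complex_of_real (real k * inverse ((a + 1 / 2 + real n) ^ Suc k))) sums
      complex_of_real (real k * ((- 1) ^ Suc k * Polygamma k (a + 1 / 2) / fact k))" .
  moreover have "complex_of_real (real k * inverse ((a + 1 / 2 + real n) ^ Suc k)) =
      of_nat k / of_real (a + 1 / 2 + real n) ^ Suc k" for n
    by (simp only: divide_inverse of_real_mult of_real_inverse of_real_power of_real_of_nat_eq)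
  ultimately
  have "(\<lambda>n. of_nat k / of_real (a + 1 / 2 + real n) ^ Suc k) sums
      complex_of_real (real k * ((- 1) ^ Suc k * Polygamma k (a + 1 / 2) / fact k))"
    by (simp only:)
  with inverse_moment_sums[OF assms]
  have "inverse_moment k a = complex_of_real (real k * ((- 1) ^ Suc k * Polygamma k (a + 1 / 2) / fact k))"
    by (rule sums_unique2)
  also have "real k * ((- 1) ^ Suc k * Polygamma k (a + 1 / 2) / fact k) =
      (- 1) ^ (k - 1) / fact (k - 1) * Polygamma k (a + 1 / 2)"
    using \<open>k \<ge> 1\<close> by (cases k) (simp_all add: field_simps del: of_nat_Suc)
  finally show ?thesis .
qed

lemma inverse_moment_half:
  assumes "k \<ge> 1"
  shows "inverse_moment k (1 / 2) = of_nat k * zeta (of_nat (k + 1))"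
proof -
  have "(\<lambda>n. of_nat k * (1 / of_nat (Suc n) powr of_nat (k + 1))) sums inverse_moment k (1 / 2)"
  proof -
    have "of_nat k / of_real (1 / 2 + 1 / 2 + real n) ^ Suc k =
        of_nat k * (1 / (of_nat (Suc n) :: complex) powr of_nat (k + 1))" for n
      by (subst powr_nat') (auto simp: add_ac)
    then show ?thesis
      using inverse_moment_sums[of "1 / 2" k] assms by simp
  qed
  from sums_divide[OF this, of "of_nat k"]
  have "(\<lambda>n. 1 / (of_nat (Suc n) :: complex) powr of_nat (k + 1)) sums
      (inverse_moment k (1 / 2) / of_nat k)"
    using assms by (simp only: nonzero_mult_div_cancel_left of_nat_eq_0_iff not_one_le_zero)
  then show ?thesis
    using assms by (simp only: zeta_def sums_unique[symmetric]) simp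
qed

section \<open>Negative powers of the Bernoulli umbra\<close>

lemma
  assumes "distributed M lborel L (\<lambda>u. ennreal (logistic_density u))"
  shows integrable_logistic_inverse_power:
      "a \<noteq> 0 \<Longrightarrow> integrable M (\<lambda>\<omega>. (complex_of_real a + \<i> * of_real (L \<omega>)) powi (- int k))"
    and integral_logistic_inverse_power:
      "(LINT \<omega>|M. (complex_of_real a + \<i> * of_real (L \<omega>)) powi (- int k)) = inverse_moment k a"
proof -
  define h where "h = (\<lambda>u. (complex_of_real a + \<i> * of_real u) powi (- int k))"
  have h_eq: "logistic_density u *\<^sub>R h u = of_real (logistic_density u) / (of_real a + \<i> * of_real u) ^ k" for u
    by (simp add: h_def power_int_minus divide_inverse scaleR_conv_of_real)
  have [measurable]: "h \<in> borel_measurable borel"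
    unfolding h_def power_int_minus power_int_of_nat by measurable
  have [measurable]: "L \<in> borel_measurable M"
    using distributed_measurable[OF assms] by simp
  have distr: "distr M lborel L = density lborel logistic_density"
    using distributed_distr_eq_density[OF assms] .
  have "integrable M (\<lambda>\<omega>. h (L \<omega>)) \<longleftrightarrow> integrable (distr M lborel L) h"
    by (subst integrable_distr_eq) auto
  also have "\<dots> \<longleftrightarrow> integrable lborel (\<lambda>u. logistic_density u *\<^sub>R h u)"
    unfolding distr by (intro integrable_density) (auto simp: logistic_density_nonneg)
  finally show "integrable M (\<lambda>\<omega>. (complex_of_real a + \<i> * of_real (L \<omega>)) powi (- int k))" if "a \<noteq> 0"
    using integrable_inverse_moment[OF that, of k] unfolding h_eq by (simp add: h_def)
  have "(LINT \<omega>|M. h (L \<omega>)) = integral\<^sup>L (distr M lborel L) h"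
    by (subst integral_distr) auto
  also have "\<dots> = (LINT u|lborel. logistic_density u *\<^sub>R h u)"
    unfolding distr by (intro integral_density) (auto simp: logistic_density_nonneg)
  finally show "(LINT \<omega>|M. (complex_of_real a + \<i> * of_real (L \<omega>)) powi (- int k)) = inverse_moment k a"
    unfolding h_eq inverse_moment_def by (simp add: h_def)
qed

lemma higher_deriv_Digamma_real:
  fixes x :: real
  assumes "x > 0"
  shows "(deriv ^^ k) Digamma x = Polygamma k x"
  using assms by (subst higher_deriv_Polygamma) (auto elim!: nonpos_Ints_cases)

theorem mainTheorem4:
  fixes M :: "'a measure" and L :: "'a \<Rightarrow> real" and k :: nat
  assumes "prob_space M"
    and "distributed M lborel L (\<lambda>u. ennreal (logistic_density u))"
    and "k \<ge> 1"
  shows "(\<forall>x::real. x \<noteq> 1/2 \<longrightarrow>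
            integrable M (\<lambda>\<omega>. (complex_of_real (x - 1/2) + \<i> * complex_of_real (L \<omega>)) powi (- int k)) \<and>
            bernoulli_umbra M L (\<lambda>u. u powi (- int k)) x =
              complex_of_real
                (if x > 1/2
                 then (-1) ^ (k - 1) / fact (k - 1) * (deriv ^^ k) Digamma x
                 else - (1 / fact (k - 1)) * (deriv ^^ k) Digamma (1 - x))) \<and>
         bernoulli_umbra M L (\<lambda>u. u powi (- int k)) 1 =
           integral\<^sup>L M (\<lambda>\<omega>. (1/2 + \<i> * complex_of_real (L \<omega>)) powi (- int k)) \<and>
         integral\<^sup>L M (\<lambda>\<omega>. (1/2 + \<i> * complex_of_real (L \<omega>)) powi (- int k)) =
           of_nat k * zeta (of_nat (k + 1))"
proof (intro conjI allI impI)
  note integral = integral_logistic_inverse_power[OF assms(2)]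
  fix x :: real
  assume "x \<noteq> 1/2"
  then show "integrable M (\<lambda>\<omega>. (complex_of_real (x - 1/2) + \<i> * complex_of_real (L \<omega>)) powi (- int k))"
    by (intro integrable_logistic_inverse_power[OF assms(2)]) simp
  have "inverse_moment k (x - 1/2) = complex_of_real
      (if x > 1/2
       then (-1) ^ (k - 1) / fact (k - 1) * (deriv ^^ k) Digamma x
       else - (1 / fact (k - 1)) * (deriv ^^ k) Digamma (1 - x))"
  proof (cases "x > 1/2")
    case True
    then show ?thesis
      using inverse_moment_eq_Polygamma[of "x - 1/2" k] \<open>k \<ge> 1\<close>
      by (simp add: higher_deriv_Digamma_real)
  next
    case False
    with \<open>x \<noteq> 1/2\<close> have "x < 1/2"
      by simp
    have sign: "(- 1) ^ k * (- 1) ^ (k - 1) = (- 1 :: real)"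
      using \<open>k \<ge> 1\<close> by (cases k) (auto simp flip: power_mult_distrib)
    have "inverse_moment k (x - 1/2) = (- 1) ^ k * inverse_moment k (1/2 - x)"
      using inverse_moment_minus[of k "1/2 - x"] by simp
    also have "\<dots> = of_real (((- 1) ^ k * (- 1) ^ (k - 1)) / fact (k - 1) * Polygamma k (1 - x))"
      using inverse_moment_eq_Polygamma[of "1/2 - x" k] \<open>k \<ge> 1\<close> \<open>x < 1/2\<close>
      by simp
    also have "\<dots> = of_real (- (1 / fact (k - 1)) * (deriv ^^ k) Digamma (1 - x))"
      using \<open>x < 1/2\<close> by (simp only: sign higher_deriv_Digamma_real) (simp add: higher_deriv_Digamma_real)
    finally show ?thesis
      using False by simp
  qed
  then show "bernoulli_umbra M L (\<lambda>u. u powi (- int k)) x = complex_of_real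
      (if x > 1/2
       then (-1) ^ (k - 1) / fact (k - 1) * (deriv ^^ k) Digamma x
       else - (1 / fact (k - 1)) * (deriv ^^ k) Digamma (1 - x))"
    unfolding bernoulli_umbra_def integral .
next
  show "bernoulli_umbra M L (\<lambda>u. u powi (- int k)) 1 =
      integral\<^sup>L M (\<lambda>\<omega>. (1/2 + \<i> * complex_of_real (L \<omega>)) powi (- int k))"
    by (simp add: bernoulli_umbra_def)
next
  show "integral\<^sup>L M (\<lambda>\<omega>. (1/2 + \<i> * complex_of_real (L \<omega>)) powi (- int k)) =
      of_nat k * zeta (of_nat (k + 1))"
    using integral_logistic_inverse_power[OF assms(2), where a = "1/2" and k = k] inverse_moment_half[OF \<open>k \<ge> 1\<close>]
    by simp
qed

end
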